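(* Up to inner automorphism, the subalgebras of $A_2$ isomorphic to the $2$-dimensional abelian Lie algebra $K_1$ are classified by the list $$\begin{array}{l} K_1^1=\langle x_1+x_2, x_3\rangle,\\ K_1^2=\langle x_1, h_1+2h_2\rangle,\\ K_1^3=\langle x_1, x_3\rangle,\\ K_1^4=\langle x_1, y_2\rangle,\\ K_1^5=\langle h_1, h_2\rangle. \end{array}$$ That is, every subalgebra of $A_2$ isomorphic to $K_1$ is equivalent to exactly one of these five subalgebras, each of which is isomorphic to $K_1$.
   Context: $A_2$ is the Lie algebra of traceless $3\times3$ complex matrices. Its Chevalley basis $x_i,y_i$ ($1\le i\le 3$), $h_1,h_2$ is defined by $$ah_1+bh_2+cx_1+dx_2+ex_3+c'y_1+d'y_2+e'y_3=\begin{pmatrix} a & c & -e\\ c' & b-a & d\\ -e' & d' & -b\end{pmatrix}.$$ $\langle W_1,\dots,W_m\rangle$ denotes the Lie subalgebra of $A_2$ generated by $W_1,\dots,W_m$. Two subalgebras are equivalent if an inner automorphism of $A_2$ maps one onto the other, i.e. if they are conjugate by an element of $\mathrm{SL}(3,\mathbb{C})$. *)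

theory Defs
  imports "HOL-Analysis.Analysis"
begin

text \<open>
  The library's scalar multiplication \<open>(*s)\<close> on \<open>'a ^ 'n\<close> takes scalars from the entry type \<open>'a\<close>,
  so on matrices it is not multiplication by complex numbers, and \<open>(*\<^sub>R)\<close> is only real.
\<close>

definition cscale :: "complex \<Rightarrow> complex^3^3 \<Rightarrow> complex^3^3" where
  "cscale c A = (\<chi> i j. c * A $ i $ j)"

interpretation cmat: vector_space cscale
  by unfold_locales (simp_all add: cscale_def vec_eq_iff algebra_simps)

definition lie_bracket :: "complex^3^3 \<Rightarrow> complex^3^3 \<Rightarrow> complex^3^3" where
  "lie_bracket A B = A ** B - B ** A"

definition A2 :: "(complex^3^3) set" where
  "A2 = {A. trace A = 0}"

definition lie_subalgebra :: "(complex^3^3) set \<Rightarrow> bool" where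
  "lie_subalgebra L \<longleftrightarrow>
     L \<subseteq> A2 \<and> cmat.subspace L \<and> (\<forall>A\<in>L. \<forall>B\<in>L. lie_bracket A B \<in> L)"

definition lie_generated :: "(complex^3^3) set \<Rightarrow> (complex^3^3) set" where
  "lie_generated S = \<Inter>{L. lie_subalgebra L \<and> S \<subseteq> L}"

lemma lie_subalgebra_A2: "lie_subalgebra A2"
proof -
  have "trace (lie_bracket A B) = 0" for A B
    by (simp only: lie_bracket_def trace_sub trace_mul_sym [of A B] diff_self)
  moreover have "trace (cscale c A) = c * trace A" for c A
    by (simp add: trace_def cscale_def sum_distrib_left)
  moreover have "trace (0 :: complex^3^3) = 0"
    by (simp add: trace_def)
  ultimately show ?thesis
    by (simp add: lie_subalgebra_def A2_def cmat.subspace_def trace_add)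
qed

lemma lie_subalgebra_generated:
  assumes "S \<subseteq> A2"
  shows "lie_subalgebra (lie_generated S)"
proof -
  have "lie_generated S \<subseteq> A2"
    using assms lie_subalgebra_A2 unfolding lie_generated_def by blast
  moreover have "cmat.subspace (lie_generated S)"
    unfolding lie_generated_def
    by (rule cmat.subspace_Inter) (simp add: lie_subalgebra_def)
  moreover have "lie_bracket A B \<in> lie_generated S"
    if "A \<in> lie_generated S" "B \<in> lie_generated S" for A B
    unfolding lie_generated_def
  proof (rule InterI)
    fix L assume L: "L \<in> {L. lie_subalgebra L \<and> S \<subseteq> L}"
    then have "A \<in> L" "B \<in> L"
      using that unfolding lie_generated_def by (simp_all only: Inter_iff)
    then show "lie_bracket A B \<in> L"
      using L by (simp add: lie_subalgebra_def)
  qed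
  ultimately show ?thesis
    by (simp add: lie_subalgebra_def)
qed

text \<open>
  Isomorphism of complex Lie algebras, each given by a carrier set \<open>L\<close>, its scalar multiplication
  and its bracket. The map is constrained on the carrier only.
\<close>

definition lie_isomorphic ::
  "'b::ab_group_add set \<Rightarrow> (complex \<Rightarrow> 'b \<Rightarrow> 'b) \<Rightarrow> ('b \<Rightarrow> 'b \<Rightarrow> 'b) \<Rightarrow>
   'c::ab_group_add set \<Rightarrow> (complex \<Rightarrow> 'c \<Rightarrow> 'c) \<Rightarrow> ('c \<Rightarrow> 'c \<Rightarrow> 'c) \<Rightarrow> bool" where
  "lie_isomorphic L scl br L' scl' br' \<longleftrightarrow>
     (\<exists>f. bij_betw f L L' \<and>
          (\<forall>A\<in>L. \<forall>B\<in>L. f (A + B) = f A + f B) \<and>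
          (\<forall>c. \<forall>A\<in>L. f (scl c A) = scl' c (f A)) \<and>
          (\<forall>A\<in>L. \<forall>B\<in>L. f (br A B) = br' (f A) (f B)))"

text \<open>The model of \<open>K\<^sub>1\<close> is the vector space \<open>complex^2\<close> with the zero bracket.\<close>

definition isomorphic_K1 :: "(complex^3^3) set \<Rightarrow> bool" where
  "isomorphic_K1 L \<longleftrightarrow>
     lie_isomorphic L cscale lie_bracket (UNIV :: (complex^2) set) (*s) (\<lambda>_ _. 0)"

definition inner_aut :: "(complex^3^3 \<Rightarrow> complex^3^3) \<Rightarrow> bool" where
  "inner_aut \<phi> \<longleftrightarrow> (\<exists>P. det P = 1 \<and> \<phi> = (\<lambda>A. P ** A ** matrix_inv P))"

definition equivalent_subalgebras :: "(complex^3^3) set \<Rightarrow> (complex^3^3) set \<Rightarrow> bool" where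
  "equivalent_subalgebras L L' \<longleftrightarrow> (\<exists>\<phi>. inner_aut \<phi> \<and> \<phi> ` L = L')"

text \<open>
  \<open>chevalley a b c d e c' d' e'\<close> is
  \<open>a h\<^sub>1 + b h\<^sub>2 + c x\<^sub>1 + d x\<^sub>2 + e x\<^sub>3 + c' y\<^sub>1 + d' y\<^sub>2 + e' y\<^sub>3\<close>.
  The lists in \<open>vector\<close> are the rows.
\<close>

definition chevalley ::
  "complex \<Rightarrow> complex \<Rightarrow> complex \<Rightarrow> complex \<Rightarrow> complex \<Rightarrow> complex \<Rightarrow> complex \<Rightarrow> complex \<Rightarrow> complex^3^3" where
  "chevalley a b c d e c' d' e' =
     vector [vector [a, c, - e],
             vector [c', b - a, d],
             vector [- e', d', - b]]"

definition h\<^sub>1 :: "complex^3^3" where "h\<^sub>1 = chevalley 1 0 0 0 0 0 0 0"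
definition h\<^sub>2 :: "complex^3^3" where "h\<^sub>2 = chevalley 0 1 0 0 0 0 0 0"
definition x\<^sub>1 :: "complex^3^3" where "x\<^sub>1 = chevalley 0 0 1 0 0 0 0 0"
definition x\<^sub>2 :: "complex^3^3" where "x\<^sub>2 = chevalley 0 0 0 1 0 0 0 0"
definition x\<^sub>3 :: "complex^3^3" where "x\<^sub>3 = chevalley 0 0 0 0 1 0 0 0"
definition y\<^sub>1 :: "complex^3^3" where "y\<^sub>1 = chevalley 0 0 0 0 0 1 0 0"
definition y\<^sub>2 :: "complex^3^3" where "y\<^sub>2 = chevalley 0 0 0 0 0 0 1 0"
definition y\<^sub>3 :: "complex^3^3" where "y\<^sub>3 = chevalley 0 0 0 0 0 0 0 1"

lemma chevalley_expansion:
  "chevalley a b c d e c' d' e' =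
     cscale a h\<^sub>1 + cscale b h\<^sub>2 + cscale c x\<^sub>1 + cscale d x\<^sub>2 + cscale e x\<^sub>3 +
     cscale c' y\<^sub>1 + cscale d' y\<^sub>2 + cscale e' y\<^sub>3"
  by (simp add: vec_eq_iff forall_3 cscale_def chevalley_def
      h\<^sub>1_def h\<^sub>2_def x\<^sub>1_def x\<^sub>2_def x\<^sub>3_def y\<^sub>1_def y\<^sub>2_def y\<^sub>3_def)

definition K1_list :: "(complex^3^3) set list" where
  "K1_list =
    [lie_generated {x\<^sub>1 + x\<^sub>2, x\<^sub>3},
     lie_generated {x\<^sub>1, h\<^sub>1 + cscale 2 h\<^sub>2},
     lie_generated {x\<^sub>1, x\<^sub>3},
     lie_generated {x\<^sub>1, y\<^sub>2},
     lie_generated {h\<^sub>1, h\<^sub>2}]"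

end

theory Submission
  imports Defs "HOL-Computational_Algebra.Fundamental_Theorem_Algebra"
begin

text \<open>
  A two-dimensional abelian subalgebra is spanned by two commuting traceless matrices \<open>A\<close>, \<open>B\<close>,
  which can be triangularised simultaneously. Consider the map that sends an element of the
  triangular span to its diagonal. If it has rank 2, some element has distinct eigenvalues;
  diagonalising it diagonalises everything, and the span becomes \<open>\<langle>h\<^sub>1, h\<^sub>2\<rangle>\<close>. If it has rank 1 and no
  element has distinct eigenvalues, some element has diagonal proportional to a permutation of
  \<open>(1, 1, -2)\<close>, and splitting off the simple eigenvalue leaves \<open>\<langle>x\<^sub>1, h\<^sub>1 + 2h\<^sub>2\<rangle>\<close>. If it vanishes,
  commutativity makes the superdiagonals of all elements proportional to one pair \<open>(\<delta>, \<epsilon>)\<close>, and the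
  cases \<open>\<delta> = 0\<close>, \<open>\<epsilon> = 0\<close>, \<open>\<delta>\<epsilon> \<noteq> 0\<close> give \<open>\<langle>x\<^sub>1, y\<^sub>2\<rangle>\<close>, \<open>\<langle>x\<^sub>1, x\<^sub>3\<rangle>\<close>, \<open>\<langle>x\<^sub>1 + x\<^sub>2, x\<^sub>3\<rangle>\<close>.

  The five algebras are told apart by whether all elements have square or cube zero, by the existence
  of a nonzero element of square zero, and by the existence of a vector on which no nonzero element
  vanishes.
\<close>

section \<open>Lie algebras spanned by commuting pairs\<close>

lemmas mat3_simps = vec_eq_iff forall_3 sum_3 matrix_matrix_mult_def cscale_def trace_def

lemma span_pair: "cmat.span {A, B} = {cscale c A + cscale d B | c d. True}"
  by (auto simp: cmat.span_insert diff_eq_eq add.commute)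

lemma det_cscale: "det (cscale k P) = k ^ 3 * det P"
  by (simp add: det_3 cscale_def algebra_simps power3_eq_cube)

lemma cscale_mult_left: "cscale k A ** B = cscale k (A ** B)"
  by (simp add: mat3_simps algebra_simps)

lemma matrix_add_rdistrib: "(A + B) ** C = A ** C + B ** (C :: 'a::semiring_1^'n^'m)"
  by (simp add: vec_eq_iff matrix_matrix_mult_def sum.distrib algebra_simps)

lemma cscale_mult_right: "A ** cscale k B = cscale k (A ** B)"
  by (simp add: mat3_simps algebra_simps)

lemma matrix_inv_right:
  fixes P :: "'a::field^'n^'n"
  assumes "det P \<noteq> 0"
  shows "P ** matrix_inv P = mat 1"
  using assms someI_ex [of "\<lambda>Q. P ** Q = mat 1 \<and> Q ** P = mat 1"]
  unfolding invertible_det_nz [symmetric] invertible_def matrix_inv_def by blast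

lemma complex_cube_root: "\<exists>k::complex. k ^ 3 = d"
proof (cases "d = 0")
  case False
  then have "exp (Ln d / 3) ^ 3 = d"
    by (simp flip: exp_of_nat_mult)
  then show ?thesis ..
qed auto

text \<open>An inner automorphism requires determinant 1. Multiplying \<open>P\<close> by a cube
  root of \<open>inverse (det P)\<close> achieves this and keeps the intertwining relations, whose
  form without inverses eases later computations.\<close>

lemma equivalent_span_pairI:
  assumes P: "det P \<noteq> 0" and A: "P ** A = A' ** P" and B: "P ** B = B' ** P"
  shows "equivalent_subalgebras (cmat.span {A, B}) (cmat.span {A', B'})"
proof -
  obtain k where k: "k ^ 3 = inverse (det P)" using complex_cube_root by blast
  define Q where "Q = cscale k P"
  have dQ: "det Q = 1" using k P by (simp add: Q_def det_cscale)
  then have inv: "Q ** matrix_inv Q = mat 1" by (simp add: matrix_inv_right)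
  have QA: "Q ** A = A' ** Q" and QB: "Q ** B = B' ** Q"
    by (simp_all add: Q_def cscale_mult_left cscale_mult_right A B)
  define \<phi> where "\<phi> = (\<lambda>X. Q ** X ** matrix_inv Q)"
  have "\<phi> A = A'" "\<phi> B = B'"
    unfolding \<phi>_def QA QB by (simp_all add: inv flip: matrix_mul_assoc)
  moreover have "\<phi> (cscale c X + cscale d Y) = cscale c (\<phi> X) + cscale d (\<phi> Y)" for c d X Y
    by (simp add: \<phi>_def matrix_add_ldistrib matrix_add_rdistrib
        cscale_mult_left cscale_mult_right)
  moreover have "cmat.span {X, Y} = range (\<lambda>p. cscale (fst p) X + cscale (snd p) Y)" for X Y
    by (force simp: span_pair image_def)
  ultimately have "\<phi> ` cmat.span {A, B} = cmat.span {A', B'}"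
    by (simp only: image_image)
  then show ?thesis
    using dQ by (auto simp: equivalent_subalgebras_def inner_aut_def \<phi>_def)
qed

section \<open>Independent commuting pairs and two-dimensional abelian subalgebras\<close>

text \<open>Unlike independence of the set \<open>{A, B}\<close>, this also excludes
  \<open>A = B\<close>.\<close>

definition independent_pair :: "complex^3^3 \<Rightarrow> complex^3^3 \<Rightarrow> bool" where
  "independent_pair A B \<longleftrightarrow> (\<forall>c d. cscale c A + cscale d B = 0 \<longrightarrow> c = 0 \<and> d = 0)"

text \<open>Cramer's rule: \<open>D\<close> is the determinant of the change of basis, and once
  \<open>D\<close> is known to be nonzero, \<open>A\<close> and \<open>B\<close> are recovered from
  \<open>A'\<close> and \<open>B'\<close>.\<close>

lemma span_pair_eqI:
  assumes "A' \<in> cmat.span {A, B}" "B' \<in> cmat.span {A, B}" and ind: "independent_pair A' B'"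
  shows "cmat.span {A, B} = cmat.span {A', B'}"
proof -
  obtain a b c d where A': "A' = cscale a A + cscale b B" and B': "B' = cscale c A + cscale d B"
    using assms by (auto simp: span_pair)
  define D where "D = a * d - b * c"
  have A: "cscale d A' + cscale (- b) B' = cscale D A"
    and B: "cscale (- c) A' + cscale a B' = cscale D B"
    by (simp_all add: A' B' D_def vec_eq_iff cscale_def algebra_simps)
  have "D \<noteq> 0"
  proof
    assume "D = 0"
    with A B have "cscale d A' + cscale (- b) B' = 0" "cscale (- c) A' + cscale a B' = 0"
      by simp_all
    with ind have "b = 0" "a = 0" unfolding independent_pair_def by (metis neg_equal_0_iff_equal)+
    then have "cscale 1 A' + cscale 0 B' = 0" by (simp add: A')
    with ind show False by (auto simp: independent_pair_def simp del: cmat.scale_one)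
  qed
  have "A = cscale (inverse D) (cscale d A' + cscale (- b) B')"
    "B = cscale (inverse D) (cscale (- c) A' + cscale a B')"
    unfolding A B using \<open>D \<noteq> 0\<close> by simp_all
  moreover have "cscale (inverse D) (cscale d A' + cscale (- b) B') \<in> cmat.span {A', B'}"
     "cscale (inverse D) (cscale (- c) A' + cscale a B') \<in> cmat.span {A', B'}"
    by (intro cmat.span_scale cmat.span_add cmat.span_base; simp)+
  ultimately have "A \<in> cmat.span {A', B'}" "B \<in> cmat.span {A', B'}" by simp_all
  with assms show ?thesis by (auto simp: cmat.span_eq)
qed

lemma lie_bracket_combination:
  assumes "A ** B = B ** A"
  shows "lie_bracket (cscale a A + cscale b B) (cscale c A + cscale d B) = 0"
  using assms by (simp add: lie_bracket_def matrix_add_ldistrib matrix_add_rdistrib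
      cscale_mult_left cscale_mult_right cmat.scale_right_distrib mult.commute algebra_simps)

text \<open>All brackets within the span vanish, so the span is already a subalgebra, and it lies in
  every subalgebra that contains the pair.\<close>

lemma lie_generated_pair:
  assumes "trace A = 0" "trace B = 0" "A ** B = B ** A"
  shows "lie_generated {A, B} = cmat.span {A, B}" and "lie_subalgebra (cmat.span {A, B})"
proof -
  show L: "lie_subalgebra (cmat.span {A, B})"
    unfolding lie_subalgebra_def
  proof (intro conjI ballI)
    show "cmat.span {A, B} \<subseteq> A2"
      using assms lie_subalgebra_A2 unfolding lie_subalgebra_def
      by (intro cmat.span_minimal) (auto simp: A2_def)
  next
    fix X Y assume "X \<in> cmat.span {A, B}" "Y \<in> cmat.span {A, B}"
    then have "lie_bracket X Y = 0"
      using assms(3) by (auto simp: span_pair lie_bracket_combination)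
    then show "lie_bracket X Y \<in> cmat.span {A, B}" by (simp add: cmat.span_zero)
  qed simp
  show "lie_generated {A, B} = cmat.span {A, B}"
  proof
    show "lie_generated {A, B} \<subseteq> cmat.span {A, B}"
      using L by (auto simp: lie_generated_def intro: cmat.span_base)
    show "cmat.span {A, B} \<subseteq> lie_generated {A, B}"
      unfolding lie_generated_def lie_subalgebra_def
      by (intro Inter_greatest cmat.span_minimal) auto
  qed
qed

text \<open>The coordinate map \<open>g\<close> is a linear bijection from \<open>complex^2\<close>
  onto the span. Its inverse is the isomorphism, since brackets vanish on both sides.\<close>

lemma isomorphic_K1_span_pair:
  assumes com: "A ** B = B ** A" and ind: "independent_pair A B"
  shows "isomorphic_K1 (cmat.span {A, B})"
proof -
  define g :: "complex^2 \<Rightarrow> complex^3^3" where "g v = cscale (v $ 1) A + cscale (v $ 2) B" for v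
  define f where "f = the_inv g"
  have add: "g (v + w) = g v + g w" for v w by (simp add: g_def cmat.scale_left_distrib)
  have scale: "g (c *s v) = cscale c (g v)" for c v by (simp add: g_def cmat.scale_right_distrib)
  have diff: "g (v - w) = g v - g w" for v w by (simp add: g_def cmat.scale_left_diff_distrib)
  have "v = w" if "g v = g w" for v w
  proof -
    have "g (v - w) = 0" using that by (simp add: diff)
    then have "(v - w) $ 1 = 0 \<and> (v - w) $ 2 = 0"
      using ind unfolding g_def independent_pair_def by blast
    then show ?thesis by (simp add: vec_eq_iff forall_2)
  qed
  then have inj: "inj g" by (auto simp: inj_def)
  have ran: "range g = cmat.span {A, B}"
  proof (intro set_eqI iffI)
    fix X assume "X \<in> cmat.span {A, B}"
    then obtain c d where "X = cscale c A + cscale d B" by (auto simp: span_pair)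
    then have "X = g (vector [c, d])" by (simp add: g_def)
    then show "X \<in> range g" by blast
  qed (auto simp: g_def span_pair)
  have f: "f (g v) = v" for v using inj by (simp add: f_def the_inv_f_f)
  have br: "lie_bracket (g v) (g w) = 0" for v w
    using com by (simp add: g_def lie_bracket_combination)
  have g0: "g 0 = 0" by (simp add: g_def)
  have "bij_betw f (range g) UNIV"
    using bij_betw_the_inv_into [of g UNIV "range g"] inj by (simp add: f_def bij_betw_def)
  moreover have "f (X + Y) = f X + f Y" if "X \<in> range g" "Y \<in> range g" for X Y
    using that by (auto simp: f simp flip: add)
  moreover have "f (cscale c X) = c *s f X" if "X \<in> range g" for X c
    using that by (auto simp: f simp flip: scale)
  moreover have "f (lie_bracket X Y) = 0" if "X \<in> range g" "Y \<in> range g" for X Y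
    using that f [of 0] by (auto simp: br g0)
  ultimately show ?thesis
    unfolding isomorphic_K1_def lie_isomorphic_def ran [symmetric] by (intro exI [of _ f]) auto
qed

text \<open>The preimages of the standard basis vectors span \<open>L\<close>. They commute because
  their bracket lies in \<open>L\<close> and has image 0, and the isomorphism is injective on
  \<open>L\<close>.\<close>

lemma isomorphic_K1_obtain_pair:
  assumes L: "lie_subalgebra L" and "isomorphic_K1 L"
  obtains A B where "L = cmat.span {A, B}" "trace A = 0" "trace B = 0" "A ** B = B ** A"
    "independent_pair A B"
proof -
  obtain f :: "complex^3^3 \<Rightarrow> complex^2" where bij: "bij_betw f L UNIV"
    and add: "\<And>X Y. X \<in> L \<Longrightarrow> Y \<in> L \<Longrightarrow> f (X + Y) = f X + f Y"
    and scale: "\<And>c X. X \<in> L \<Longrightarrow> f (cscale c X) = c *s f X"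
    and br: "\<And>X Y. X \<in> L \<Longrightarrow> Y \<in> L \<Longrightarrow> f (lie_bracket X Y) = 0"
    using assms(2) unfolding isomorphic_K1_def lie_isomorphic_def by auto
  have sub: "cmat.subspace L" and "L \<subseteq> A2" and cl: "\<And>X Y. X \<in> L \<Longrightarrow> Y \<in> L \<Longrightarrow> lie_bracket X Y \<in> L"
    using L by (auto simp: lie_subalgebra_def)
  have inj: "X = Y" if "X \<in> L" "Y \<in> L" "f X = f Y" for X Y
    using bij that by (auto simp: bij_betw_def inj_on_def)
  have "vector [1, 0] \<in> f ` L" "vector [0, 1] \<in> f ` L" using bij by (auto simp: bij_betw_def)
  then obtain A B where A: "A \<in> L" "f A = vector [1, 0]" and B: "B \<in> L" "f B = vector [0, 1]"
    by (metis imageE)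
  have zero: "0 \<in> L" using sub by (rule cmat.subspace_0)
  have f0: "f 0 = 0" using scale [OF zero, of 0] by simp
  have comb: "cscale c A + cscale d B \<in> L" for c d
    using sub A B by (simp add: cmat.subspace_add cmat.subspace_scale)
  have fcomb: "f (cscale c A + cscale d B) = vector [c, d]" for c d
    using A B sub by (simp add: add scale cmat.subspace_scale vec_eq_iff forall_2)
  have "L = cmat.span {A, B}"
  proof (intro set_eqI iffI)
    fix X assume "X \<in> L"
    have "f X = f (cscale (f X $ 1) A + cscale (f X $ 2) B)"
      by (simp add: fcomb vec_eq_iff forall_2)
    then show "X \<in> cmat.span {A, B}"
      using inj [OF \<open>X \<in> L\<close> comb] by (auto simp: span_pair)
  qed (use comb in \<open>auto simp: span_pair\<close>)
  moreover have "lie_bracket A B = 0"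
    using inj [OF cl [OF A(1) B(1)] zero] br [OF A(1) B(1)] f0 by simp
  moreover have "independent_pair A B"
    unfolding independent_pair_def
  proof (intro allI impI)
    fix c d assume "cscale c A + cscale d B = 0"
    then have "vector [c, d] = (0 :: complex^2)" using fcomb f0 by metis
    then show "c = 0 \<and> d = 0" by (simp add: vec_eq_iff forall_2)
  qed
  ultimately show ?thesis
    using that A B \<open>L \<subseteq> A2\<close> by (auto simp: A2_def lie_bracket_def)
qed

section \<open>Simultaneous triangularisation\<close>

text \<open>The fundamental theorem of algebra gives one root \<open>u\<close> of
  \<open>t^3 - p t^2 + q t - r\<close>; the quadratic formula gives the roots of the quotient by
  \<open>t - u\<close>.\<close>

lemma complex_cubic_roots:
  fixes p q r :: complex
  obtains u v w where "u + v + w = p" "u * v + u * w + v * w = q" "u * v * w = r"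
proof -
  have "\<not> constant (poly [: - r, q, - p, 1 :])"
    by (simp add: constant_degree)
  then obtain u where "poly [: - r, q, - p, 1 :] u = 0"
    using fundamental_theorem_of_algebra by blast
  then have u: "r = u * (q - u * (p - u))" by (simp add: algebra_simps)
  define s where "s = csqrt ((p - u)\<^sup>2 - 4 * (q - u * (p - u)))"
  define v w where "v = (p - u + s) / 2" and "w = (p - u - s) / 2"
  have vw: "v + w = p - u" by (simp add: v_def w_def field_simps)
  have "v * w = ((p - u)\<^sup>2 - s\<^sup>2) / 4"
    by (simp add: v_def w_def power2_eq_square algebra_simps)
  then have "v * w = q - u * (p - u)"
    by (simp add: s_def diff_divide_distrib)
  with vw have "u + (v + w) = p" "u * (v + w) + v * w = q" "u * (v * w) = r"
    by (simp_all add: u)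
  then show ?thesis using that by (simp add: algebra_simps)
qed

text \<open>Cayley-Hamilton in dimension three, with the characteristic polynomial split into linear
  factors.\<close>

lemma mat3_annihilated:
  fixes B :: "complex^3^3"
  obtains u v w where "(B - mat u) ** (B - mat v) ** (B - mat w) = 0"
proof -
  define p where "p = trace B"
  \<comment> \<open>The sum of the principal 2 by 2 minors, which is the linear coefficient of the
    characteristic polynomial.\<close>
  define q where "q = B$1$1 * B$2$2 - B$1$2 * B$2$1 + B$1$1 * B$3$3 - B$1$3 * B$3$1
    + B$2$2 * B$3$3 - B$2$3 * B$3$2"
  obtain u v w where uvw: "u + v + w = p" "u * v + u * w + v * w = q" "u * v * w = det B"
    using complex_cubic_roots .
  have "(B - mat u) ** (B - mat v) ** (B - mat w) =
    B ** B ** B - cscale (u + v + w) (B ** B) + cscale (u * v + u * w + v * w) B - mat (u * v * w)"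
    by (simp add: mat3_simps mat_def algebra_simps)
  also have "\<dots> = B ** B ** B - cscale p (B ** B) + cscale q B - mat (det B)"
    by (simp only: uvw)
  also have "\<dots> = 0"
    by (simp add: mat3_simps mat_def det_3 p_def q_def algebra_simps)
  finally show ?thesis by (rule that)
qed

lemma matrix_vector_mult_mat: "mat c *v x = c *s (x :: 'a::semiring_1^'n)"
  by (simp add: vec_eq_iff matrix_vector_mult_def mat_def if_distrib [of "\<lambda>t. t * _"] cong: if_cong)

text \<open>Applying three annihilating linear factors of \<open>B\<close> to \<open>x\<close> one
  after another stays in \<open>W\<close> and ends at 0. The last nonzero vector of this chain is an
  eigenvector.\<close>

lemma eigenvector_in_invariant_subspace:
  fixes B :: "complex^3^3"
  assumes W: "vec.subspace W" and inv: "\<And>x. x \<in> W \<Longrightarrow> B *v x \<in> W" and x: "x \<in> W" "x \<noteq> 0"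
  obtains y \<beta> where "y \<in> W" "y \<noteq> 0" "B *v y = \<beta> *s y"
proof -
  obtain r s t where *: "(B - mat r) ** (B - mat s) ** (B - mat t) = 0"
    using mat3_annihilated .
  have shift: "(B - mat c) *v y = B *v y - c *s y" for c y
    by (simp add: matrix_vector_mult_diff_rdistrib matrix_vector_mult_mat)
  have shiftW: "(B - mat c) *v y \<in> W" if "y \<in> W" for c y
    unfolding shift using W inv that by (simp add: vec.subspace_diff vec.subspace_scale)
  define y where "y = (B - mat t) *v x"
  define z where "z = (B - mat s) *v y"
  have "y \<in> W" "z \<in> W" unfolding y_def z_def by (intro shiftW x)+
  have "((B - mat r) ** (B - mat s) ** (B - mat t)) *v x = 0"
    by (simp only: * matrix_vector_mult_0)
  then have "(B - mat r) *v z = 0"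
    by (simp add: y_def z_def matrix_vector_mul_assoc matrix_mul_assoc)
  then have "B *v z = r *s z" by (simp add: shift)
  show ?thesis
  proof (cases "y = 0 \<or> z = 0")
    case False
    then show ?thesis using that \<open>z \<in> W\<close> \<open>B *v z = r *s z\<close> by blast
  next
    case True
    then consider "y = 0" | "y \<noteq> 0" "z = 0" by blast
    then show ?thesis
    proof cases
      case 1
      then have "B *v x = t *s x" by (simp add: y_def shift)
      then show ?thesis using that x by blast
    next
      case 2
      then have "B *v y = s *s y" by (simp add: z_def shift)
      then show ?thesis using that \<open>y \<in> W\<close> \<open>y \<noteq> 0\<close> by blast
    qed
  qed
qed

text \<open>Commuting with \<open>A\<close>, the matrix \<open>B\<close> preserves an eigenspace of
  \<open>A\<close> within \<open>W\<close>, and so has an eigenvector there.\<close>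

lemma common_eigenvector:
  fixes A B :: "complex^3^3"
  assumes com: "A ** B = B ** A" and W: "vec.subspace W"
    and A: "\<And>x. x \<in> W \<Longrightarrow> A *v x \<in> W" and B: "\<And>x. x \<in> W \<Longrightarrow> B *v x \<in> W"
    and x: "x \<in> W" "x \<noteq> 0"
  obtains y \<alpha> \<beta> where "y \<in> W" "y \<noteq> 0" "A *v y = \<alpha> *s y" "B *v y = \<beta> *s y"
proof -
  obtain x' \<alpha> where x': "x' \<in> W" "x' \<noteq> 0" "A *v x' = \<alpha> *s x'"
    using eigenvector_in_invariant_subspace [OF W A x] by blast
  define E where "E = {y \<in> W. A *v y = \<alpha> *s y}"
  have "vec.subspace E"
    using W by (auto simp: E_def vec.subspace_def vec.add vec.scale algebra_simps
        vector_add_ldistrib mult.commute)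
  moreover have "B *v y \<in> E" if "y \<in> E" for y
  proof -
    have "A *v (B *v y) = B *v (A *v y)" by (simp add: matrix_vector_mul_assoc com)
    then show ?thesis using that B by (simp add: E_def vec.scale)
  qed
  moreover have "x' \<in> E" using x' by (simp add: E_def)
  ultimately obtain y \<beta> where "y \<in> E" "y \<noteq> 0" "B *v y = \<beta> *s y"
    using eigenvector_in_invariant_subspace [of E B x'] x' by blast
  then show ?thesis using that by (auto simp: E_def)
qed

text \<open>
  The column \<open>u\<close> solves \<open>v \<times> u = w\<close>, so that \<open>det P = (v \<times> u) \<bullet> z = w \<bullet> z\<close> for the last column \<open>z\<close>.
\<close>

lemma basis_adapted_to_flag:
  fixes v w :: "complex^3"
  assumes "v \<noteq> 0" "w \<noteq> 0" and vw: "w$1 * v$1 + w$2 * v$2 + w$3 * v$3 = 0"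
  obtains P :: "complex^3^3" where "det P \<noteq> 0" "column 1 P = v"
    "(w v* P) $ 1 = 0" "(w v* P) $ 2 = 0" "(w v* P) $ 3 \<noteq> 0"
proof -
  have "\<exists>a b c. v$2 * c - v$3 * b = w$1 \<and> v$3 * a - v$1 * c = w$2 \<and> v$1 * b - v$2 * a = w$3"
  proof -
    \<comment> \<open>The system is solvable because \<open>w\<close> annihilates \<open>v\<close>.
      The witness is 0 at the position of the chosen nonzero coordinate of \<open>v\<close>.\<close>
    consider "v$1 \<noteq> 0" | "v$2 \<noteq> 0" | "v$3 \<noteq> 0"
      using \<open>v \<noteq> 0\<close> by (auto simp: vec_eq_iff forall_3)
    then show ?thesis
    proof cases
      case 1
      with vw have "v$2 * (- w$2 / v$1) - v$3 * (w$3 / v$1) = w$1"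
        by (simp add: divide_simps) algebra
      with 1 show ?thesis
        by (intro exI [of _ 0] exI [of _ "w$3 / v$1"] exI [of _ "- w$2 / v$1"]) auto
    next
      case 2
      with vw have "v$3 * (- w$3 / v$2) - v$1 * (w$1 / v$2) = w$2"
        by (simp add: divide_simps) algebra
      with 2 show ?thesis
        by (intro exI [of _ "- w$3 / v$2"] exI [of _ 0] exI [of _ "w$1 / v$2"]) auto
    next
      case 3
      with vw have "v$1 * (- w$1 / v$3) - v$2 * (w$2 / v$3) = w$3"
        by (simp add: divide_simps) algebra
      with 3 show ?thesis
        by (intro exI [of _ "w$2 / v$3"] exI [of _ "- w$1 / v$3"] exI [of _ 0]) auto
    qed
  qed
  then obtain a b c where u: "w$1 = v$2 * c - v$3 * b" "w$2 = v$3 * a - v$1 * c" "w$3 = v$1 * b - v$2 * a"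
    by metis
  have "\<exists>z :: complex^3. w$1 * z$1 + w$2 * z$2 + w$3 * z$3 \<noteq> 0"
  proof -
    consider "w$1 \<noteq> 0" | "w$2 \<noteq> 0" | "w$3 \<noteq> 0"
      using \<open>w \<noteq> 0\<close> by (auto simp: vec_eq_iff forall_3)
    then show ?thesis
      by cases (force intro: exI [of _ "axis 1 1"] exI [of _ "axis 2 1"] exI [of _ "axis 3 1"]
          simp: axis_def)+
  qed
  then obtain z :: "complex^3" where z: "w$1 * z$1 + w$2 * z$2 + w$3 * z$3 \<noteq> 0" ..
  define P :: "complex^3^3"
    where "P = vector [vector [v$1, a, z$1], vector [v$2, b, z$2], vector [v$3, c, z$3]]"
  have "det P = w$1 * z$1 + w$2 * z$2 + w$3 * z$3"
    by (simp add: P_def det_3 u algebra_simps)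
  moreover have "column 1 P = v"
    by (simp add: P_def column_def vec_eq_iff forall_3)
  moreover have "(w v* P) $ 1 = 0" "(w v* P) $ 2 = 0"
     "(w v* P) $ 3 = w$1 * z$1 + w$2 * z$2 + w$3 * z$3"
    by (simp_all add: P_def vector_matrix_mult_def sum_3 u algebra_simps)
  ultimately show ?thesis using that z by metis
qed

definition upper_triangular3 :: "complex^3^3 \<Rightarrow> bool" where
  "upper_triangular3 A \<longleftrightarrow> A$2$1 = 0 \<and> A$3$1 = 0 \<and> A$3$2 = 0"

text \<open>A common left eigenvector \<open>w\<close> has an invariant kernel \<open>W\<close>,
  which contains a common right eigenvector \<open>v\<close>. In a basis adapted to the flag formed
  by the line of \<open>v\<close>, the plane \<open>W\<close> and the whole space, both matrices are
  triangular.\<close>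

lemma commuting_triangularisable:
  fixes A B :: "complex^3^3"
  assumes com: "A ** B = B ** A"
  obtains Q A' B' where "det Q \<noteq> 0" "Q ** A = A' ** Q" "Q ** B = B' ** Q"
    "upper_triangular3 A'" "upper_triangular3 B'"
proof -
  have com': "transpose A ** transpose B = transpose B ** transpose A"
    by (metis com matrix_transpose_mul)
  obtain w a b where w: "w \<noteq> 0" and wA: "w v* A = a *s w" and wB: "w v* B = b *s w"
  proof (rule common_eigenvector [OF com', of UNIV "axis 1 1"])
    show "axis 1 1 \<noteq> (0 :: complex^3)" by (simp add: axis_eq_0_iff)
  qed (simp_all add: vec.subspace_UNIV)
  define W where "W = {x :: complex^3. w$1 * x$1 + w$2 * x$2 + w$3 * x$3 = 0}"
  have W: "vec.subspace W"
    by (auto simp: W_def vec.subspace_def) algebra+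
  have invW: "M *v x \<in> W" if "w v* M = c *s w" "x \<in> W" for M c x
  proof -
    have "w$1 * (M *v x)$1 + w$2 * (M *v x)$2 + w$3 * (M *v x)$3
        = (w v* M)$1 * x$1 + (w v* M)$2 * x$2 + (w v* M)$3 * x$3"
      by (simp add: matrix_vector_mult_def vector_matrix_mult_def sum_3 algebra_simps)
    also have "\<dots> = c * (w$1 * x$1 + w$2 * x$2 + w$3 * x$3)"
      by (simp add: that algebra_simps)
    finally show ?thesis using that(2) by (simp add: W_def)
  qed
  have "\<exists>x. x \<in> W \<and> x \<noteq> 0"
  proof (cases "w$1 = 0")
    case True
    then show ?thesis
      by (intro exI [of _ "vector [1, 0, 0]"]) (simp add: W_def vec_eq_iff forall_3)
  next
    case False
    then show ?thesis
      by (intro exI [of _ "vector [w$2, - w$1, 0]"]) (simp add: W_def vec_eq_iff forall_3)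
  qed
  then obtain v c d where v: "v \<in> W" "v \<noteq> 0" and vA: "A *v v = c *s v" and vB: "B *v v = d *s v"
    using common_eigenvector [OF com W invW [OF wA] invW [OF wB]] by blast
  obtain P :: "complex^3^3" where P: "det P \<noteq> 0" "column 1 P = v"
    "(w v* P) $ 1 = 0" "(w v* P) $ 2 = 0" "(w v* P) $ 3 \<noteq> 0"
    using basis_adapted_to_flag [OF v(2) w] v(1) unfolding W_def by blast
  define Q where "Q = matrix_inv P"
  have PQ: "P ** Q = mat 1" unfolding Q_def by (rule matrix_inv_right) fact
  then have QP: "Q ** P = mat 1" by (simp add: matrix_left_right_inverse)
  have dQ: "det Q \<noteq> 0" using PQ det_mul [of P Q] by auto
  \<comment> \<open>The right eigenvector clears the first column below the diagonal; the left
    eigenvector clears the entry in row 3, column 2.\<close>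
  have tri: "upper_triangular3 (Q ** M ** P)" if M: "M *v v = c *s v" and wM: "w v* M = a *s w" for M a c
  proof -
    define N where "N = Q ** M ** P"
    have PN: "P ** N = M ** P" by (simp add: N_def matrix_mul_assoc PQ)
    have col1: "column 1 X = X *v axis 1 1" for X :: "complex^3^3"
      by (simp add: vec_eq_iff column_def matrix_vector_mult_def axis_def sum_3)
    have "column 1 N = N *v axis 1 1" by (rule col1)
    also have "\<dots> = Q *v (M *v column 1 P)"
      by (simp add: N_def matrix_vector_mul_assoc matrix_mul_assoc col1)
    also have "\<dots> = c *s (Q *v column 1 P)" by (simp add: P M vec.scale)
    also have "Q *v column 1 P = axis 1 1"
      by (simp add: matrix_vector_mul_assoc QP col1)
    finally have "column 1 N $ i = (c *s axis 1 1) $ i" for i by simp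
    then have col: "N $ i $ 1 = (c *s axis 1 1) $ i" for i by (simp add: column_def)
    \<comment> \<open>\<open>w v* P\<close> is a left eigenvector of \<open>N\<close> and a nonzero
      multiple of the third coordinate row, so its second entry isolates
      \<open>N $ 3 $ 2\<close>.\<close>
    have "(w v* P) v* N = (w v* M) v* P"
      by (simp add: vector_matrix_mul_assoc PN)
    also have "\<dots> = a *s (w v* P)"
      unfolding wM by (simp add: vec_eq_iff vector_matrix_mult_def sum_distrib_left mult_ac)
    finally have "((w v* P) v* N) $ 2 = a * (w v* P) $ 2" by simp
    then have "(w v* P) $ 3 * N $ 3 $ 2 = 0"
      using P by (simp add: vector_matrix_mult_def [of "w v* P"] sum_3)
    with P have "N $ 3 $ 2 = 0" by simp
    with col [of 2] col [of 3] show ?thesis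
      unfolding N_def [symmetric] upper_triangular3_def by (simp add: axis_def)
  qed
  have "Q ** M = (Q ** M ** P) ** Q" for M by (simp add: PQ flip: matrix_mul_assoc)
  then show ?thesis using that dQ tri [OF vA wA] tri [OF vB wB] by blast
qed

section \<open>Normal forms of commuting upper triangular pairs\<close>

lemmas chevalley_basis_simps = chevalley_def h\<^sub>1_def h\<^sub>2_def x\<^sub>1_def x\<^sub>2_def x\<^sub>3_def y\<^sub>2_def

lemma K1_pairs:
  "independent_pair (x\<^sub>1 + x\<^sub>2) x\<^sub>3" "independent_pair x\<^sub>1 (h\<^sub>1 + cscale 2 h\<^sub>2)"
  "independent_pair x\<^sub>1 x\<^sub>3" "independent_pair x\<^sub>1 y\<^sub>2" "independent_pair h\<^sub>1 h\<^sub>2"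
  "(x\<^sub>1 + x\<^sub>2) ** x\<^sub>3 = x\<^sub>3 ** (x\<^sub>1 + x\<^sub>2)" "x\<^sub>1 ** (h\<^sub>1 + cscale 2 h\<^sub>2) = (h\<^sub>1 + cscale 2 h\<^sub>2) ** x\<^sub>1"
  "x\<^sub>1 ** x\<^sub>3 = x\<^sub>3 ** x\<^sub>1" "x\<^sub>1 ** y\<^sub>2 = y\<^sub>2 ** x\<^sub>1" "h\<^sub>1 ** h\<^sub>2 = h\<^sub>2 ** h\<^sub>1"
  "trace (x\<^sub>1 + x\<^sub>2) = 0" "trace x\<^sub>1 = 0" "trace x\<^sub>3 = 0" "trace y\<^sub>2 = 0"
  "trace h\<^sub>1 = 0" "trace h\<^sub>2 = 0" "trace (h\<^sub>1 + cscale 2 h\<^sub>2) = 0"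
  by (simp_all add: independent_pair_def chevalley_basis_simps mat3_simps)

lemma K1_list_eq_spans:
  "K1_list =
    [cmat.span {x\<^sub>1 + x\<^sub>2, x\<^sub>3}, cmat.span {x\<^sub>1, h\<^sub>1 + cscale 2 h\<^sub>2}, cmat.span {x\<^sub>1, x\<^sub>3},
     cmat.span {x\<^sub>1, y\<^sub>2}, cmat.span {h\<^sub>1, h\<^sub>2}]"
  by (simp add: K1_list_def lie_generated_pair K1_pairs)

lemma K1_list_subalgebras: "K \<in> set K1_list \<Longrightarrow> lie_subalgebra K \<and> isomorphic_K1 K"
  by (auto simp: K1_list_eq_spans lie_generated_pair isomorphic_K1_span_pair K1_pairs)

section \<open>Conjugating a pair into a subspace\<close>

text \<open>The images need not span \<open>S\<close>, so dependent pairs are allowed. The case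
  analysis can then ignore independence, which enters only in
  \<open>equivalent_if_conjugable\<close>.\<close>

definition conjugable_into :: "complex^3^3 \<Rightarrow> complex^3^3 \<Rightarrow> (complex^3^3) set \<Rightarrow> bool" where
  "conjugable_into A B S \<longleftrightarrow>
    (\<exists>P. det P \<noteq> 0 \<and> (\<exists>A'\<in>S. P ** A = A' ** P) \<and> (\<exists>B'\<in>S. P ** B = B' ** P))"

lemma conjugable_into_conj:
  assumes "conjugable_into A' B' S" "det Q \<noteq> 0" "Q ** A = A' ** Q" "Q ** B = B' ** Q"
  shows "conjugable_into A B S"
proof -
  obtain P A'' B'' where P: "det P \<noteq> 0" "A'' \<in> S" "P ** A' = A'' ** P" "B'' \<in> S" "P ** B' = B'' ** P"
    using assms(1) by (auto simp: conjugable_into_def)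
  have "(P ** Q) ** A = A'' ** (P ** Q)" "(P ** Q) ** B = B'' ** (P ** Q)"
    by (metis P assms matrix_mul_assoc)+
  moreover have "det (P ** Q) \<noteq> 0" using P assms by (simp add: det_mul)
  ultimately show ?thesis using P unfolding conjugable_into_def by blast
qed

text \<open>Permits a pair to be exchanged for more convenient elements with the same span.\<close>

lemma conjugable_into_combination:
  assumes "conjugable_into A B S" "cmat.subspace S" "A' \<in> cmat.span {A, B}" "B' \<in> cmat.span {A, B}"
  shows "conjugable_into A' B' S"
proof -
  obtain P X Y where P: "det P \<noteq> 0" "X \<in> S" "P ** A = X ** P" "Y \<in> S" "P ** B = Y ** P"
    using assms(1) by (auto simp: conjugable_into_def)
  have "P ** (cscale c A + cscale d B) = (cscale c X + cscale d Y) ** P" for c d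
    by (simp add: matrix_add_ldistrib matrix_add_rdistrib cscale_mult_left cscale_mult_right P)
  moreover have "cscale c X + cscale d Y \<in> S" for c d
    using P assms(2) by (simp add: cmat.subspace_add cmat.subspace_scale)
  moreover obtain a b c d where "A' = cscale a A + cscale b B" "B' = cscale c A + cscale d B"
    using assms(3,4) by (auto simp: span_pair)
  ultimately show ?thesis using P(1) unfolding conjugable_into_def by blast
qed

text \<open>Conjugation preserves independence, so the images of the pair form a basis of the target
  span.\<close>

lemma equivalent_if_conjugable:
  assumes "conjugable_into A B (cmat.span {X, Y})" and ind: "independent_pair A B"
  shows "equivalent_subalgebras (cmat.span {A, B}) (cmat.span {X, Y})"
proof -
  obtain P A' B' where P: "det P \<noteq> 0" "P ** A = A' ** P" "P ** B = B' ** P"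
    and S: "A' \<in> cmat.span {X, Y}" "B' \<in> cmat.span {X, Y}"
    using assms(1) by (auto simp: conjugable_into_def)
  have "P ** matrix_inv P = mat 1" using P(1) by (rule matrix_inv_right)
  then have inv: "matrix_inv P ** P = mat 1" by (simp add: matrix_left_right_inverse)
  have "independent_pair A' B'"
    unfolding independent_pair_def
  proof (intro allI impI)
    fix c d assume 0: "cscale c A' + cscale d B' = 0"
    have "cscale c A + cscale d B = (matrix_inv P ** P) ** (cscale c A + cscale d B)"
      by (simp add: inv)
    also have "\<dots> = matrix_inv P ** ((cscale c A' + cscale d B') ** P)"
      by (simp add: matrix_add_ldistrib matrix_add_rdistrib cscale_mult_left cscale_mult_right P
          flip: matrix_mul_assoc)
    also have "\<dots> = 0" by (simp add: 0)
    finally show "c = 0 \<and> d = 0" using ind by (simp add: independent_pair_def)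
  qed
  then have "cmat.span {X, Y} = cmat.span {A', B'}" using S by (rule span_pair_eqI [rotated 2])
  then show ?thesis using equivalent_span_pairI [OF P] by simp
qed

definition classified :: "complex^3^3 \<Rightarrow> complex^3^3 \<Rightarrow> bool" where
  "classified A B \<longleftrightarrow> (\<exists>K\<in>set K1_list. conjugable_into A B K)"

lemma classified_conj:
  assumes "classified A' B'" "det Q \<noteq> 0" "Q ** A = A' ** Q" "Q ** B = B' ** Q"
  shows "classified A B"
  using assms conjugable_into_conj unfolding classified_def by blast

lemma classified_combination:
  assumes "classified A B" "A' \<in> cmat.span {A, B}" "B' \<in> cmat.span {A, B}"
  shows "classified A' B'"
proof -
  have "cmat.subspace K" if "K \<in> set K1_list" for K
    using that K1_list_subalgebras lie_subalgebra_def by blast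
  then show ?thesis
    using assms conjugable_into_combination unfolding classified_def by blast
qed

lemma classified_commute: "classified A B \<Longrightarrow> classified B A"
  by (erule classified_combination) (simp_all add: cmat.span_base)

lemma classifiedI:
  assumes "cmat.span {X, Y} \<in> set K1_list" "det P \<noteq> 0"
    "P ** A = (cscale a X + cscale b Y) ** P" "P ** B = (cscale c X + cscale d Y) ** P"
  shows "classified A B"
proof -
  have "cscale k X + cscale l Y \<in> cmat.span {X, Y}" for k l by (auto simp: span_pair)
  then show ?thesis
    using assms unfolding classified_def conjugable_into_def by blast
qed

section \<open>Coordinates for upper triangular matrices\<close>

definition ut3 :: "complex \<Rightarrow> complex \<Rightarrow> complex \<Rightarrow> complex \<Rightarrow> complex \<Rightarrow> complex \<Rightarrow> complex^3^3" where
  "ut3 a b c d e f = vector [vector [a, d, f], vector [0, b, e], vector [0, 0, c]]"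

lemma upper_triangular3_obtain:
  assumes "upper_triangular3 A"
  obtains a b c d e f where "A = ut3 a b c d e f"
proof
  show "A = ut3 (A$1$1) (A$2$2) (A$3$3) (A$1$2) (A$2$3) (A$1$3)"
    using assms by (simp add: upper_triangular3_def ut3_def vec_eq_iff forall_3)
qed

lemma ut3_eq_iff:
  "ut3 a b c d e f = ut3 a' b' c' d' e' f' \<longleftrightarrow> a = a' \<and> b = b' \<and> c = c' \<and> d = d' \<and> e = e' \<and> f = f'"
  by (auto simp: ut3_def vec_eq_iff forall_3)

lemma ut3_mult:
  "ut3 a b c d e f ** ut3 a' b' c' d' e' f' =
    ut3 (a * a') (b * b') (c * c') (a * d' + d * b') (b * e' + e * c') (a * f' + d * e' + f * c')"
  by (simp add: ut3_def mat3_simps)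

lemma ut3_0: "0 = ut3 0 0 0 0 0 0"
  by (simp add: ut3_def vec_eq_iff forall_3)

lemma ut3_add:
  "ut3 a b c d e f + ut3 a' b' c' d' e' f' = ut3 (a + a') (b + b') (c + c') (d + d') (e + e') (f + f')"
  by (simp add: ut3_def vec_eq_iff forall_3)

lemma ut3_cscale: "cscale k (ut3 a b c d e f) = ut3 (k * a) (k * b) (k * c) (k * d) (k * e) (k * f)"
  by (simp add: ut3_def mat3_simps)

lemma ut3_trace: "trace (ut3 a b c d e f) = a + b + c"
  by (simp add: ut3_def mat3_simps)

lemma ut3_det: "det (ut3 a b c d e f) = a * b * c"
  by (simp add: ut3_def det_3)

text \<open>The commutator has zero diagonal, which leaves one scalar equation for each entry above
  it.\<close>

lemma ut3_commute_iff:
  "ut3 a b c d e f ** ut3 a' b' c' d' e' f' = ut3 a' b' c' d' e' f' ** ut3 a b c d e f \<longleftrightarrow>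
    (a - b) * d' = (a' - b') * d \<and> (b - c) * e' = (b' - c') * e \<and>
    (a - c) * f' + d * e' = (a' - c') * f + d' * e"
  by (simp add: ut3_mult ut3_eq_iff algebra_simps)

lemma chevalley_basis_ut3:
  "x\<^sub>1 = ut3 0 0 0 1 0 0" "x\<^sub>2 = ut3 0 0 0 0 1 0" "x\<^sub>3 = ut3 0 0 0 0 0 (- 1)"
  "h\<^sub>1 = ut3 1 (- 1) 0 0 0 0" "h\<^sub>2 = ut3 0 1 (- 1) 0 0 0"
  by (simp_all add: chevalley_basis_simps ut3_def vec_eq_iff forall_3)

lemmas ut3_simps = ut3_mult ut3_eq_iff ut3_add ut3_cscale ut3_trace ut3_det

section \<open>Case distinction on the diagonals\<close>

text \<open>A matrix that commutes with one having distinct eigenvalues is diagonal in the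
  eigenbasis of the latter. The rows of \<open>ut3 1 1 1 x y z\<close> are left eigenvectors of the
  first matrix.\<close>

lemma classified_distinct_diagonal:
  assumes com: "ut3 a b c d e f ** ut3 a' b' c' d' e' f' = ut3 a' b' c' d' e' f' ** ut3 a b c d e f"
    and tr: "a + b + c = 0" "a' + b' + c' = 0" and ne: "a \<noteq> b" "b \<noteq> c" "a \<noteq> c"
  shows "classified (ut3 a b c d e f) (ut3 a' b' c' d' e' f')"
proof -
  define x where "x = d / (a - b)"
  define y where "y = e / (b - c)"
  define z where "z = (f + x * e) / (a - c)"
  have d: "d = x * (a - b)" and e: "e = y * (b - c)" and z: "z * (a - c) = f + x * e"
    using ne by (simp_all add: x_def y_def z_def)
  have eqs: "(a - b) * d' = (a' - b') * d" "(b - c) * e' = (b' - c') * e"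
    "(a - c) * f' + d * e' = (a' - c') * f + d' * e"
    using com by (simp_all add: ut3_commute_iff)
  have d': "d' = x * (a' - b')" and e': "e' = y * (b' - c')"
    using eqs(1,2) ne by (simp_all add: d e)
  have "(a - c) * (z * (a' - c')) = (a - c) * (f' + x * e')"
    using eqs(3) z unfolding d e d' e' by algebra
  then have z': "z * (a' - c') = f' + x * e'" using ne by simp
  have c: "c = - a - b" "c' = - a' - b'" using tr by algebra+
  show ?thesis
  \<comment> \<open>A traceless diagonal matrix with entries \<open>a\<close>, \<open>b\<close>,
    \<open>c\<close> equals \<open>a\<close> times \<open>h\<^sub>1\<close> minus \<open>c\<close>
    times \<open>h\<^sub>2\<close>.\<close>
  proof (rule classifiedI [of h\<^sub>1 h\<^sub>2 "ut3 1 1 1 x y z"])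
    show "ut3 1 1 1 x y z ** ut3 a b c d e f = (cscale a h\<^sub>1 + cscale (- c) h\<^sub>2) ** ut3 1 1 1 x y z"
      using tr z by (simp add: chevalley_basis_ut3 ut3_simps d e) (simp add: c algebra_simps)
    show "ut3 1 1 1 x y z ** ut3 a' b' c' d' e' f' = (cscale a' h\<^sub>1 + cscale (- c') h\<^sub>2) ** ut3 1 1 1 x y z"
      using tr z' by (simp add: chevalley_basis_ut3 ut3_simps d' e') (simp add: c algebra_simps)
  qed (simp_all add: K1_list_eq_spans ut3_det)
qed

text \<open>Trace zero and a nonzero diagonal leave one double and one simple eigenvalue, in the
  ratio of 1 to -2, as in \<open>h\<^sub>1 + cscale 2 h\<^sub>2\<close>. The second matrix is
  nilpotent and preserves both generalised eigenspaces, so it vanishes on the simple one and becomes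
  a multiple of \<open>x\<^sub>1\<close>.\<close>

lemma classified_repeated_diagonal:
  assumes com: "ut3 a b c d e f ** ut3 0 0 0 d' e' f' = ut3 0 0 0 d' e' f' ** ut3 a b c d e f"
    and tr: "a + b + c = 0" and eq: "a = b \<or> b = c \<or> a = c" and nz: "a \<noteq> 0 \<or> b \<noteq> 0"
  shows "classified (ut3 a b c d e f) (ut3 0 0 0 d' e' f')"
proof -
  have eqs: "(a - b) * d' = 0" "(b - c) * e' = 0" "(a - c) * f' + d * e' = d' * e"
    using com by (simp_all add: ut3_commute_iff)
  have K: "cmat.span {x\<^sub>1, h\<^sub>1 + cscale 2 h\<^sub>2} \<in> set K1_list" by (simp add: K1_list_eq_spans)
  have sums: "c = - a - b" "a = - b - c" "b = - a - c" using tr by algebra+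
  have "(b = a \<and> c = - (2 * a) \<and> a \<noteq> 0) \<or> (c = b \<and> a = - (2 * b) \<and> b \<noteq> 0) \<or>
    (c = a \<and> b = - (2 * a) \<and> a \<noteq> 0)"
    using eq
  proof (elim disjE)
    assume "a = b"
    then have "c = - (2 * a)" using sums(1) by simp
    then show ?thesis using \<open>a = b\<close> nz by blast
  next
    assume "b = c"
    then have "a = - (2 * b)" using sums(2) by simp
    then show ?thesis using \<open>b = c\<close> nz by auto
  next
    assume "a = c"
    then have "b = - (2 * a)" using sums(3) by simp
    then show ?thesis using \<open>a = c\<close> nz by auto
  qed
  then consider "b = a" "c = - (2 * a)" "a \<noteq> 0" | "c = b" "a = - (2 * b)" "b \<noteq> 0"
    | "c = a" "b = - (2 * a)" "a \<noteq> 0"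
    by blast
  then show ?thesis
  proof cases
    case 1
    txt \<open>
      In each case the rows of the conjugating matrix are a left Jordan basis of the first matrix,
      with the eigenvector of the simple eigenvalue last.
    \<close>
    define y where "y = e / (3 * a)"
    define z where "z = (f - d * y) / (3 * a)"
    have e: "e = 3 * a * y" and f: "f = 3 * a * z + d * y" using 1 by (simp_all add: y_def z_def)
    have "e' = 0" using eqs(2) 1 by simp
    then have "3 * a * f' = 3 * a * (d' * y)" using eqs(3) 1 e by simp
    then have "f' = d' * y" using 1 by simp
    show ?thesis
      by (rule classifiedI [OF K, of
            "vector [vector [1, 0, z], vector [0, 1, y], vector [0, 0, 1]]"
            _ d a _ d' 0])
        (simp_all add: \<open>e' = 0\<close> \<open>f' = d' * y\<close> 1 e f det_3 mat3_simps ut3_def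
          chevalley_basis_simps algebra_simps)
  next
    case 2
    define s where "s = - d / (3 * b)"
    define t where "t = - (f + s * e) / (3 * b)"
    have d: "d = - 3 * b * s" and f: "f = - 3 * b * t - s * e" using 2 by (simp_all add: s_def t_def)
    have "d' = 0" using eqs(1) 2 by simp
    have "- 3 * b * (f' + s * e') = (a - c) * f' + d * e'" by (simp add: 2 d algebra_simps)
    also have "\<dots> = 0" using eqs(3) \<open>d' = 0\<close> by simp
    finally have "f' = - s * e'" using 2 by (simp add: eq_neg_iff_add_eq_0)
    show ?thesis
      by (rule classifiedI [OF K, of
            "vector [vector [0, 1, 0], vector [0, 0, 1], vector [1, s, t]]"
            _ e b _ e' 0])
        (simp_all add: \<open>d' = 0\<close> \<open>f' = - s * e'\<close> 2 d f det_3 mat3_simps ut3_def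
          chevalley_basis_simps algebra_simps)
  next
    case 3
    define s where "s = d / (3 * a)"
    define t where "t = - e / (3 * a)"
    have d: "d = 3 * a * s" and e: "e = - 3 * a * t" using 3 by (simp_all add: s_def t_def)
    have "d' = 0" "e' = 0" using eqs(1,2) 3 by simp_all
    \<comment> \<open>The first row is sent by the first matrix to \<open>a\<close> times itself
      plus \<open>f + s * e\<close> times the second row, whence the coefficient of
      \<open>x\<^sub>1\<close>.\<close>
    show ?thesis
      by (rule classifiedI [OF K, of
            "vector [vector [1, s, 0], vector [0, 0, 1], vector [0, 1, t]]"
            _ "f + s * e" a _ f' 0])
        (simp_all add: \<open>d' = 0\<close> \<open>e' = 0\<close> 3 d e det_3 mat3_simps ut3_def
          chevalley_basis_simps algebra_simps)
  qed
qed

lemma classified_strictly_upper: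
  assumes com: "ut3 0 0 0 d e f ** ut3 0 0 0 d' e' f' = ut3 0 0 0 d' e' f' ** ut3 0 0 0 d e f"
  shows "classified (ut3 0 0 0 d e f) (ut3 0 0 0 d' e' f')"
proof -
  have eq: "d * e' = d' * e" using com by (simp add: ut3_commute_iff)
  consider "d = 0" "d' = 0" | "e = 0" "e' = 0" | "\<not> (d = 0 \<and> d' = 0)" "\<not> (e = 0 \<and> e' = 0)" by blast
  then show ?thesis
  proof cases
    case 1
    \<comment> \<open>Exchanging the last two coordinates moves the corner entry to the place of
      \<open>x\<^sub>1\<close> and the entry \<open>e\<close> to the place of
      \<open>y\<^sub>2\<close>.\<close>
    show ?thesis
      by (rule classifiedI [of x\<^sub>1 y\<^sub>2
            "vector [vector [1, 0, 0], vector [0, 0, 1], vector [0, 1, 0]]"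
            _ f e _ f' e'])
        (simp_all add: 1 K1_list_eq_spans det_3 ut3_def mat3_simps chevalley_basis_simps)
  next
    case 2
    \<comment> \<open>The sign of \<open>f\<close> changes because \<open>x\<^sub>3\<close> has
      corner entry -1.\<close>
    show ?thesis
      by (rule classifiedI [of x\<^sub>1 x\<^sub>3 "ut3 1 1 1 0 0 0" _ d "- f" _ d' "- f'"])
        (simp_all add: 2 K1_list_eq_spans chevalley_basis_ut3 ut3_simps)
  next
    case 3
    \<comment> \<open>The common ratio of the two superdiagonal entries. Conjugation by the diagonal
      matrix with entries \<open>p\<close>, 1, 1 scales the first of them by \<open>p\<close> and so
      makes them equal.\<close>
    have "\<exists>p. p \<noteq> 0 \<and> p * d = e \<and> p * d' = e'"
    proof (cases "d = 0")
      case False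
      then have "e \<noteq> 0" using 3 eq by auto
      then show ?thesis using False eq by (intro exI [of _ "e / d"]) (simp add: divide_simps mult.commute)
    next
      case True
      then have "d' \<noteq> 0" "e = 0" "e' \<noteq> 0" using 3 eq by auto
      then show ?thesis using True by (intro exI [of _ "e' / d'"]) simp
    qed
    then obtain p where p: "p \<noteq> 0" "e = p * d" "e' = p * d'" by blast
    show ?thesis
      by (rule classifiedI [of "x\<^sub>1 + x\<^sub>2" x\<^sub>3 "ut3 p 1 1 0 0 0"
            _ "p * d" "- p * f" _ "p * d'" "- p * f'"])
        (simp_all add: p K1_list_eq_spans chevalley_basis_ut3 ut3_simps)
  qed
qed

lemma classified_upper_triangular:
  assumes com: "ut3 a b c d e f ** ut3 a' b' c' d' e' f' = ut3 a' b' c' d' e' f' ** ut3 a b c d e f"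
    and tr: "a + b + c = 0" "a' + b' + c' = 0"
  shows "classified (ut3 a b c d e f) (ut3 a' b' c' d' e' f')"
proof -
  have eqs: "(a - b) * d' = (a' - b') * d" "(b - c) * e' = (b' - c') * e"
    "(a - c) * f' + d * e' = (a' - c') * f + d' * e"
    using com by (simp_all add: ut3_commute_iff)
  have c: "c = - a - b" "c' = - a' - b'" using tr by algebra+
  have rank1: "classified (ut3 a b c d e f) (ut3 a' b' c' d' e' f')"
    if com: "ut3 a b c d e f ** ut3 a' b' c' d' e' f' = ut3 a' b' c' d' e' f' ** ut3 a b c d e f"
      and tr: "a + b + c = 0" "a' + b' + c' = 0"
      and nz: "a \<noteq> 0 \<or> b \<noteq> 0" and dep: "a * b' = b * a'"
    for a b c d e f a' b' c' d' e' f'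
  proof -
    have "\<exists>t. a' = t * a \<and> b' = t * b"
    proof (cases "a = 0")
      case False
      then show ?thesis using dep by (intro exI [of _ "a' / a"]) (simp add: divide_simps mult.commute)
    next
      case True
      then show ?thesis using dep nz by (intro exI [of _ "b' / b"]) simp
    qed
    then obtain t where t: "a' = t * a" "b' = t * b" by blast
    have c': "c' = t * c" using tr t by algebra
    \<comment> \<open>Subtracting \<open>t\<close> times the first matrix clears the diagonal of the
      second without changing the span.\<close>
    let ?A = "ut3 a b c d e f" and ?B = "ut3 0 0 0 (d' - t * d) (e' - t * e) (f' - t * f)"
    have com': "?A ** ?B = ?B ** ?A"
      using com unfolding ut3_commute_iff t c' by (simp add: algebra_simps)
    have "classified ?A ?B"
    proof (cases "a = b \<or> b = c \<or> a = c")
      case True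
      then show ?thesis using classified_repeated_diagonal [OF com'] tr nz by blast
    next
      case False
      then show ?thesis using classified_distinct_diagonal [OF com'] tr by simp
    qed
    moreover have "ut3 a' b' c' d' e' f' = cscale t ?A + cscale 1 ?B"
      by (simp add: ut3_simps t c')
    moreover have "cscale t ?A + cscale 1 ?B \<in> cmat.span {?A, ?B}"
      unfolding span_pair by blast
    ultimately show ?thesis
      by (simp add: classified_combination cmat.span_base)
  qed
  consider "a * b' \<noteq> b * a'" | "a * b' = b * a'" "a \<noteq> 0 \<or> b \<noteq> 0"
    | "a * b' = b * a'" "a' \<noteq> 0 \<or> b' \<noteq> 0"
    | "a = 0" "b = 0" "a' = 0" "b' = 0" by blast
  then show ?thesis
  proof cases
    case 1
    \<comment> \<open>Cramer's rule replaces the pair by a basis of its span with diagonals (1, 0,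
      -1) and (0, 1, -1), so that distinct eigenvalues are available.\<close>
    define k where "k = inverse (a * b' - b * a')"
    have k: "k * (a * b' - b * a') = 1" using 1 by (simp add: k_def)
    define A1 where "A1 = ut3 1 0 (- 1)
      (k * (b' * d - b * d')) (k * (b' * e - b * e')) (k * (b' * f - b * f'))"
    define B1 where "B1 = ut3 0 1 (- 1)
      (k * (a * d' - a' * d)) (k * (a * e' - a' * e)) (k * (a * f' - a' * f))"
    have "A1 ** B1 = B1 ** A1"
      unfolding A1_def B1_def ut3_commute_iff using eqs k c by algebra
    then have "classified A1 B1"
      unfolding A1_def B1_def by (rule classified_distinct_diagonal) auto
    moreover have "a * (k * (b' * x - b * x')) + b * (k * (a * x' - a' * x)) = x"
       "a' * (k * (b' * x - b * x')) + b' * (k * (a * x' - a' * x)) = x'" for x x'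
      using k by algebra+
    then have "ut3 a b c d e f = cscale a A1 + cscale b B1"
      "ut3 a' b' c' d' e' f' = cscale a' A1 + cscale b' B1"
      unfolding A1_def B1_def ut3_simps c by simp_all
    moreover have "cscale k A1 + cscale l B1 \<in> cmat.span {A1, B1}" for k l
      unfolding span_pair by blast
    ultimately show ?thesis
      by (simp add: classified_combination)
  next
    case 2
    then show ?thesis using rank1 [OF com tr] by blast
  next
    case 3
    then show ?thesis using rank1 [OF com [symmetric] tr(2,1)] by (metis classified_commute mult.commute)
  next
    case 4
    then show ?thesis using classified_strictly_upper com c by simp
  qed
qed

section \<open>From triangular pairs to arbitrary commuting pairs\<close>

lemma trace_similar:
  fixes Q :: "complex^3^3"
  assumes "det Q \<noteq> 0" "Q ** A = A' ** Q"
  shows "trace A' = trace A"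
proof -
  have inv: "Q ** matrix_inv Q = mat 1" using assms(1) by (rule matrix_inv_right)
  have "A' = (Q ** A) ** matrix_inv Q" by (simp add: assms(2) inv flip: matrix_mul_assoc)
  then have "trace A' = trace ((Q ** A) ** matrix_inv Q)" by (rule arg_cong)
  also have "\<dots> = trace (matrix_inv Q ** (Q ** A))" by (rule trace_mul_sym)
  also have "matrix_inv Q ** Q = mat 1" using inv by (simp add: matrix_left_right_inverse)
  then have "matrix_inv Q ** (Q ** A) = A" by (simp add: matrix_mul_assoc)
  finally show ?thesis .
qed

lemma classified_commuting:
  assumes com: "A ** B = B ** A" and tr: "trace A = 0" "trace B = 0"
  shows "classified A B"
proof -
  obtain Q A' B' where Q: "det Q \<noteq> 0" "Q ** A = A' ** Q" "Q ** B = B' ** Q"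
    and ut: "upper_triangular3 A'" "upper_triangular3 B'"
    using commuting_triangularisable [OF com] .
  have inv: "Q ** matrix_inv Q = mat 1" using Q(1) by (rule matrix_inv_right)
  have "(A' ** B') ** Q = Q ** (A ** B)" "(B' ** A') ** Q = Q ** (B ** A)"
    by (metis Q matrix_mul_assoc)+
  then have "(A' ** B') ** Q = (B' ** A') ** Q" by (simp add: com)
  then have com': "A' ** B' = B' ** A'"
    by (metis inv matrix_mul_assoc matrix_mul_rid)
  have tr': "trace A' = 0" "trace B' = 0" using Q tr trace_similar by metis+
  from ut(1) obtain a b c d e f where A': "A' = ut3 a b c d e f" by (rule upper_triangular3_obtain)
  from ut(2) obtain a' b' c' d' e' f' where B': "B' = ut3 a' b' c' d' e' f'"
    by (rule upper_triangular3_obtain)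
  have "classified A' B'"
    using com' tr' unfolding A' B' ut3_trace by (rule classified_upper_triangular)
  then show ?thesis using Q by (rule classified_conj)
qed

section \<open>Conjugation invariants\<close>

lemma inner_autE:
  assumes "inner_aut \<phi>"
  obtains P Q where "\<And>A. \<phi> A = P ** A ** Q" "P ** Q = mat 1" "Q ** P = mat 1"
proof -
  obtain P where "det P = 1" "\<phi> = (\<lambda>A. P ** A ** matrix_inv P)"
    using assms by (auto simp: inner_aut_def)
  moreover from this have "P ** matrix_inv P = mat 1" by (simp add: matrix_inv_right)
  ultimately show ?thesis using that matrix_left_right_inverse by metis
qed

text \<open>Inner automorphisms respect the associative product and not only the bracket, which
  makes conditions on powers invariant.\<close>

lemma inner_aut_mult:
  assumes "inner_aut \<phi>"
  shows "\<phi> A ** \<phi> B = \<phi> (A ** B)"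
proof -
  obtain P Q where \<phi>: "\<And>A. \<phi> A = P ** A ** Q" and QP: "Q ** P = mat 1"
    using inner_autE [OF assms] by blast
  have "\<phi> A ** \<phi> B = P ** A ** (Q ** P) ** B ** Q"
    by (simp only: \<phi> matrix_mul_assoc)
  then show ?thesis
    by (simp add: \<phi> QP matrix_mul_assoc)
qed

lemma inner_aut_eq_0_iff:
  assumes "inner_aut \<phi>"
  shows "\<phi> A = 0 \<longleftrightarrow> A = 0"
proof -
  obtain P Q where \<phi>: "\<And>A. \<phi> A = P ** A ** Q" and QP: "Q ** P = mat 1"
    using inner_autE [OF assms] by blast
  have "Q ** \<phi> A ** P = (Q ** P) ** A ** (Q ** P)"
    by (simp only: \<phi> matrix_mul_assoc)
  then have "A = Q ** \<phi> A ** P"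
    by (simp add: QP)
  then have "A = 0" if "\<phi> A = 0"
    using that by simp
  then show ?thesis
    by (auto simp: \<phi>)
qed

definition square_zero :: "(complex^3^3) set \<Rightarrow> bool" where
  "square_zero L \<longleftrightarrow> (\<forall>A\<in>L. A ** A = 0)"

definition cube_zero :: "(complex^3^3) set \<Rightarrow> bool" where
  "cube_zero L \<longleftrightarrow> (\<forall>A\<in>L. A ** A ** A = 0)"

definition contains_square_zero :: "(complex^3^3) set \<Rightarrow> bool" where
  "contains_square_zero L \<longleftrightarrow> (\<exists>A\<in>L. A \<noteq> 0 \<and> A ** A = 0)"

text \<open>Evaluation at \<open>v\<close> is to be injective on \<open>L\<close>, when
  \<open>L\<close> is a subspace. This tells apart two algebras in which every element squares to
  zero.\<close>

definition has_separating_vector :: "(complex^3^3) set \<Rightarrow> bool" where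
  "has_separating_vector L \<longleftrightarrow> (\<exists>v. \<forall>A\<in>L. A *v v = 0 \<longrightarrow> A = 0)"

lemma equivalent_invariants:
  assumes "equivalent_subalgebras L L'"
  shows "square_zero L' \<longleftrightarrow> square_zero L" and "cube_zero L' \<longleftrightarrow> cube_zero L"
    and "contains_square_zero L' \<longleftrightarrow> contains_square_zero L"
    and "has_separating_vector L' \<longleftrightarrow> has_separating_vector L"
proof -
  obtain \<phi> where \<phi>: "inner_aut \<phi>" "L' = \<phi> ` L"
    using assms by (auto simp: equivalent_subalgebras_def)
  note [simp] = inner_aut_mult [OF \<phi>(1)] inner_aut_eq_0_iff [OF \<phi>(1)]
  show "square_zero L' \<longleftrightarrow> square_zero L" "cube_zero L' \<longleftrightarrow> cube_zero L"
    "contains_square_zero L' \<longleftrightarrow> contains_square_zero L"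
    by (simp_all add: \<phi>(2) square_zero_def cube_zero_def contains_square_zero_def)
  obtain P Q where PQ: "\<And>A. \<phi> A = P ** A ** Q" "P ** Q = mat 1" "Q ** P = mat 1"
    using inner_autE [OF \<phi>(1)] by blast
  have QP: "Q *v (P *v v) = v" "P *v (Q *v v) = v" for v :: "complex^3"
    by (simp_all add: matrix_vector_mul_assoc PQ)
  have P0: "P *v v = 0 \<longleftrightarrow> v = 0" for v
    using QP(1) [of v] by auto
  have "\<phi> A *v v = P *v (A *v (Q *v v))" for A v
    by (simp add: PQ(1) matrix_vector_mul_assoc matrix_mul_assoc)
  then have *: "\<phi> A *v v = 0 \<longleftrightarrow> A *v (Q *v v) = 0" for A v
    by (simp add: P0)
  show "has_separating_vector L' \<longleftrightarrow> has_separating_vector L"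
  proof
    assume "has_separating_vector L'"
    then obtain v where "\<forall>A\<in>L. \<phi> A *v v = 0 \<longrightarrow> \<phi> A = 0"
      by (auto simp: has_separating_vector_def \<phi>(2))
    then show "has_separating_vector L"
      unfolding has_separating_vector_def * by (intro exI [of _ "Q *v v"]) simp
  next
    assume "has_separating_vector L"
    then obtain v where "\<forall>A\<in>L. A *v v = 0 \<longrightarrow> A = 0"
      by (auto simp: has_separating_vector_def)
    then have "\<forall>A\<in>L. \<phi> A *v (P *v v) = 0 \<longrightarrow> \<phi> A = 0"
      unfolding * QP by simp
    then show "has_separating_vector L'"
      by (auto simp: has_separating_vector_def \<phi>(2))
  qed
qed

section \<open>Distinguishing the five subalgebras\<close>

text \<open>The square of \<open>x\<^sub>1 + x\<^sub>2\<close> is nonzero but its cube vanishes,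
  while \<open>h\<^sub>1 + cscale 2 h\<^sub>2\<close> and \<open>h\<^sub>1\<close> are nonzero
  diagonal matrices and hence not nilpotent. A diagonal matrix squares to zero only if it is
  0.\<close>

lemma K1_list_invariants:
  "map (\<lambda>K. (square_zero K, cube_zero K)) K1_list =
    [(False, True), (False, False), (True, True), (True, True), (False, False)]"
  "contains_square_zero (K1_list ! 1)" "\<not> contains_square_zero (K1_list ! 4)"
  "\<not> has_separating_vector (K1_list ! 2)" "has_separating_vector (K1_list ! 3)"
proof -
  have el: "X \<in> cmat.span {X, Y}" for X Y by (simp add: cmat.span_base)
  have el2: "Y \<in> cmat.span {X, Y}" for X Y by (simp add: cmat.span_base)
  have "\<not> square_zero (cmat.span {x\<^sub>1 + x\<^sub>2, x\<^sub>3})"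
    unfolding square_zero_def
    by (rule notI, drule bspec, rule el) (simp add: chevalley_basis_ut3 ut3_simps ut3_0)
  moreover have "cube_zero (cmat.span {x\<^sub>1 + x\<^sub>2, x\<^sub>3})"
    by (auto simp: cube_zero_def span_pair chevalley_basis_ut3 ut3_simps ut3_0)
  moreover have "\<not> square_zero (cmat.span {x\<^sub>1, h\<^sub>1 + cscale 2 h\<^sub>2})"
    unfolding square_zero_def
    by (rule notI, drule bspec, rule el2) (simp add: chevalley_basis_ut3 ut3_simps ut3_0)
  moreover have "\<not> cube_zero (cmat.span {x\<^sub>1, h\<^sub>1 + cscale 2 h\<^sub>2})"
    unfolding cube_zero_def
    by (rule notI, drule bspec, rule el2) (simp add: chevalley_basis_ut3 ut3_simps ut3_0)
  moreover have "square_zero (cmat.span {x\<^sub>1, x\<^sub>3})" "cube_zero (cmat.span {x\<^sub>1, x\<^sub>3})"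
    by (auto simp: square_zero_def cube_zero_def span_pair chevalley_basis_ut3 ut3_simps ut3_0)
  moreover have "square_zero (cmat.span {x\<^sub>1, y\<^sub>2})" "cube_zero (cmat.span {x\<^sub>1, y\<^sub>2})"
    by (auto simp: square_zero_def cube_zero_def span_pair chevalley_basis_simps mat3_simps)
  moreover have "\<not> square_zero (cmat.span {h\<^sub>1, h\<^sub>2})"
    unfolding square_zero_def
    by (rule notI, drule bspec, rule el) (simp add: chevalley_basis_ut3 ut3_simps ut3_0)
  moreover have "\<not> cube_zero (cmat.span {h\<^sub>1, h\<^sub>2})"
    unfolding cube_zero_def
    by (rule notI, drule bspec, rule el) (simp add: chevalley_basis_ut3 ut3_simps ut3_0)
  ultimately show "map (\<lambda>K. (square_zero K, cube_zero K)) K1_list =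
      [(False, True), (False, False), (True, True), (True, True), (False, False)]"
    by (simp add: K1_list_eq_spans)
  have "x\<^sub>1 \<noteq> 0" "x\<^sub>1 ** x\<^sub>1 = 0"
    by (simp_all add: chevalley_basis_ut3 ut3_simps ut3_0)
  then show "contains_square_zero (K1_list ! 1)"
    using el by (auto simp: K1_list_eq_spans contains_square_zero_def)
  show "\<not> contains_square_zero (K1_list ! 4)"
    by (auto simp: K1_list_eq_spans contains_square_zero_def span_pair
        chevalley_basis_ut3 ut3_simps ut3_0)
  show "\<not> has_separating_vector (K1_list ! 2)"
  proof
    assume "has_separating_vector (K1_list ! 2)"
    then obtain v where v: "\<And>A. A \<in> cmat.span {x\<^sub>1, x\<^sub>3} \<Longrightarrow> A *v v = 0 \<Longrightarrow> A = 0"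
      by (auto simp: K1_list_eq_spans has_separating_vector_def)
    \<comment> \<open>Every element maps \<open>v\<close> into the first coordinate axis, so
      evaluation at \<open>v\<close> cannot be injective on a two-dimensional space.\<close>
    have ker: "(cscale c x\<^sub>1 + cscale d x\<^sub>3) *v v = vector [c * v$2 - d * v$3, 0, 0]" for c d
      by (simp add: chevalley_basis_simps mat3_simps matrix_vector_mult_def)
    have sep: "c = 0 \<and> d = 0" if "c * v$2 = d * v$3" for c d
    proof -
      have "cscale c x\<^sub>1 + cscale d x\<^sub>3 = 0"
        using that by (intro v) (auto simp: span_pair ker vec_eq_iff forall_3)
      then show ?thesis by (simp add: chevalley_basis_ut3 ut3_simps ut3_0)
    qed
    \<comment> \<open>The coefficients \<open>v$3\<close> and \<open>v$2\<close> give an element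
      vanishing at \<open>v\<close>; if both are 0, then \<open>x\<^sub>1\<close> itself vanishes
      there.\<close>
    show False
      using sep [of "v$3" "v$2"] sep [of 1 0] by (simp add: mult.commute)
  qed
  \<comment> \<open>On the second basis vector \<open>x\<^sub>1\<close> and \<open>y\<^sub>2\<close>
    take independent values.\<close>
  have "A = 0" if "A \<in> cmat.span {x\<^sub>1, y\<^sub>2}" "A *v vector [0, 1, 0] = 0" for A
    using that by (auto simp: span_pair chevalley_basis_simps mat3_simps matrix_vector_mult_def)
  then show "has_separating_vector (K1_list ! 3)"
    by (auto simp: K1_list_eq_spans has_separating_vector_def)
qed

text \<open>Counting from 0, vanishing of squares and cubes separates all indices except 1 from 4
  and 2 from 3. The remaining two invariants separate these.\<close>

lemma K1_list_index_unique:
  assumes i: "i < length K1_list" "equivalent_subalgebras L (K1_list ! i)"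
    and j: "j < length K1_list" "equivalent_subalgebras L (K1_list ! j)"
  shows "i = j"
proof -
  have len: "length K1_list = 5" by (simp add: K1_list_def)
  have "map (\<lambda>K. (square_zero K, cube_zero K)) K1_list ! i =
      map (\<lambda>K. (square_zero K, cube_zero K)) K1_list ! j"
    using i j equivalent_invariants by simp
  moreover have "contains_square_zero (K1_list ! i) = contains_square_zero (K1_list ! j)"
    "has_separating_vector (K1_list ! i) = has_separating_vector (K1_list ! j)"
    using i j equivalent_invariants by simp_all
  moreover have "i \<in> {0, 1, 2, 3, 4}" "j \<in> {0, 1, 2, 3, 4}" using i j len by auto
  ultimately show ?thesis
    unfolding K1_list_invariants(1) using K1_list_invariants(2-) by auto
qed

theorem theorem6p2:
  shows "(\<forall>K \<in> set K1_list. lie_subalgebra K \<and> isomorphic_K1 K) \<and>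
         (\<forall>L. lie_subalgebra L \<and> isomorphic_K1 L \<longrightarrow>
            (\<exists>!i. i < length K1_list \<and> equivalent_subalgebras L (K1_list ! i)))"
proof (intro conjI allI impI ballI; (elim conjE)?)
  fix L assume L: "lie_subalgebra L" "isomorphic_K1 L"
  obtain A B where AB: "L = cmat.span {A, B}" "trace A = 0" "trace B = 0" "A ** B = B ** A"
    "independent_pair A B"
    using isomorphic_K1_obtain_pair [OF L] .
  obtain K where K: "K \<in> set K1_list" "conjugable_into A B K"
    using classified_commuting [OF AB(4,2,3)] by (auto simp: classified_def)
  then obtain X Y where "K = cmat.span {X, Y}" by (auto simp: K1_list_eq_spans)
  then have "equivalent_subalgebras L K"
    using equivalent_if_conjugable K(2) AB by simp
  then have "\<exists>i. i < length K1_list \<and> equivalent_subalgebras L (K1_list ! i)"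
    using K(1) by (metis in_set_conv_nth)
  then show "\<exists>!i. i < length K1_list \<and> equivalent_subalgebras L (K1_list ! i)"
    using K1_list_index_unique by blast
qed (auto simp: K1_list_subalgebras)

end
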